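(* Let $n>0$ be an integer and let $(M_n,\rho)$ denote one of $(H^n(\mathbb R),d_h)$ or $(\mathbb S^n,d_s)$. For a metric space $(X,d)$ the following conditions are equivalent: (i) $(X,d)$ is isometrically embeddable into $(M_n,\rho)$; (ii) every subspace of $X$ of size at most $n+3$ embeds isometrically into $(M_n,\rho)$.
   Context: $\langle\cdot,\cdot\rangle$ and $\|\cdot\|_2$ denote the standard inner product and Euclidean norm on $\mathbb R^k$. $\mathbb S^n=\{x\in\mathbb R^{n+1}:\|x\|_2=1\}$ is equipped with the (normalized) great-circle distance $d_s(x,y)=\frac1\pi\arccos(\langle x,y\rangle)$. The hyperbolic space $H^n(\mathbb R)$ is the set $\mathbb R^n$ equipped with the metric $d_h(x,y)=\cosh^{-1}([x][y]-\langle x,y\rangle)$ where $[x]=\sqrt{1+\|x\|_2^2}$ (and $\cosh^{-1}(t)=\log(t+\sqrt{t^2-1})$ for $t\ge1$). The size of a set is its cardinality. *)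

theory Defs
  imports "HOL-Analysis.Analysis"
begin

text \<open>The great-circle distance, normalized so that antipodal points are at distance 1.\<close>

definition sphere_dist :: "real ^ 'm \<Rightarrow> real ^ 'm \<Rightarrow> real" where
  "sphere_dist x y = arccos (x \<bullet> y) / pi"

definition hyp_weight :: "real ^ 'n \<Rightarrow> real" where
  "hyp_weight x = sqrt (1 + (norm x)\<^sup>2)"

definition hyp_dist :: "real ^ 'n \<Rightarrow> real ^ 'n \<Rightarrow> real" where
  "hyp_dist x y = arcosh (hyp_weight x * hyp_weight y - x \<bullet> y)"

text \<open>An isometric embedding is a distance-preserving map, not required to be onto.\<close>

definition isometrically_embeddable ::
    "'a set \<Rightarrow> ('a \<Rightarrow> 'a \<Rightarrow> real) \<Rightarrow> 'b set \<Rightarrow> ('b \<Rightarrow> 'b \<Rightarrow> real) \<Rightarrow> bool" where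
  "isometrically_embeddable X d M \<rho> \<longleftrightarrow>
     (\<exists>f. f ` X \<subseteq> M \<and> (\<forall>x\<in>X. \<forall>y\<in>X. \<rho> (f x) (f y) = d x y))"

end

theory Submission
  imports Defs
begin

text \<open>
  Both model spaces sit in a vector space of dimension \<open>n + 1\<close> carrying a bilinear form \<open>B\<close>, and
  their distance is an injective function of \<open>B\<close>: the unit sphere with the inner product, and
  the upper sheet of the hyperboloid \<open>B v v = -1\<close> with the Lorentz form. An isometric embedding of
  \<open>X\<close> is therefore a map into the model with a prescribed Gram kernel \<open>K\<close>.

  The decisive property of both models is that \<open>B\<close> is nondegenerate on the span of any set of
  points of the model. Consequently the linear relations between the images of finitely many points
  can be read off their Gram matrix, and do not depend on the embedding (\<open>relation_transfer\<close>).
  Choose a largest finite \<open>Y \<subseteq> X\<close> whose images under some embedding \<open>f\<close> of \<open>Y\<close> are linearly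
  independent; it has at most \<open>n + 1\<close> points. Embedding \<open>Y\<close> together with one more point \<open>x\<close>
  expresses \<open>x\<close> as a linear combination of \<open>Y\<close>, and the same combination of the vectors \<open>f y\<close>
  defines the image of \<open>x\<close>. To see that this has the right Gram kernel at a pair \<open>x, x'\<close>, embed
  \<open>Y\<close> together with both points, which are at most \<open>n + 3\<close> points in total.
\<close>

section \<open>Prescribed Gram kernels\<close>

text \<open>
  The last axiom recognises a vector as a point of the model by its values under \<open>B\<close>: the value
  \<open>B v v\<close> places it on the sphere or on the two-sheeted hyperboloid, and the value \<open>B m v\<close>
  tells the two sheets of the latter apart.
\<close>

locale gram_model =
  fixes B :: "'v::euclidean_space \<Rightarrow> 'v \<Rightarrow> real"
    and M :: "'v set"
  assumes bilinear: "bilinear B"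
    and zero_notin: "0 \<notin> M"
    and nondegenerate: "\<And>S v. S \<subseteq> M \<Longrightarrow> v \<in> span S \<Longrightarrow> (\<And>s. s \<in> S \<Longrightarrow> B v s = 0) \<Longrightarrow> v = 0"
    and recognise: "\<And>v m p q. m \<in> M \<Longrightarrow> p \<in> M \<Longrightarrow> q \<in> M \<Longrightarrow>
                      B v v = B q q \<Longrightarrow> B m v = B p q \<Longrightarrow> v \<in> M"
begin

definition realizes :: "('a \<Rightarrow> 'v) \<Rightarrow> ('a \<Rightarrow> 'a \<Rightarrow> real) \<Rightarrow> 'a set \<Rightarrow> bool" where
  "realizes f K Y \<longleftrightarrow> f ` Y \<subseteq> M \<and> (\<forall>x\<in>Y. \<forall>y\<in>Y. B (f x) (f y) = K x y)"

lemma realizes_in: "realizes f K Y \<Longrightarrow> y \<in> Y \<Longrightarrow> f y \<in> M"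
  by (auto simp: realizes_def)

lemma realizes_kernel: "realizes f K Y \<Longrightarrow> x \<in> Y \<Longrightarrow> y \<in> Y \<Longrightarrow> B (f x) (f y) = K x y"
  by (auto simp: realizes_def)

lemma realizes_mono: "realizes f K Z \<Longrightarrow> Y \<subseteq> Z \<Longrightarrow> realizes f K Y"
  by (auto simp: realizes_def)

lemma form_sum_left: "B (\<Sum>y\<in>Y. c y *\<^sub>R f y) w = (\<Sum>y\<in>Y. c y * B (f y) w)"
  using linear_sum[of "\<lambda>v. B v w" "\<lambda>y. c y *\<^sub>R f y" Y] bilinear bilinear_lmul[OF bilinear]
  by (simp add: bilinear_def)

lemma form_sum_right: "B w (\<Sum>y\<in>Y. c y *\<^sub>R f y) = (\<Sum>y\<in>Y. c y * B w (f y))"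
  using linear_sum[of "B w" "\<lambda>y. c y *\<^sub>R f y" Y] bilinear bilinear_rmul[OF bilinear]
  by (simp add: bilinear_def)

text \<open>
  A combination of the \<open>g y\<close> is orthogonal to all \<open>g z\<close> as soon as its coefficients annihilate the
  Gram matrix, a condition on \<open>K\<close> alone; nondegeneracy on the span then makes it zero.
\<close>

lemma relation_transfer:
  assumes f: "realizes f K Y" and g: "realizes g K Y"
    and zero: "(\<Sum>y\<in>Y. c y *\<^sub>R f y) = 0"
  shows "(\<Sum>y\<in>Y. c y *\<^sub>R g y) = 0"
proof (rule nondegenerate)
  show "g ` Y \<subseteq> M"
    using g by (simp add: realizes_def)
  show "(\<Sum>y\<in>Y. c y *\<^sub>R g y) \<in> span (g ` Y)"
    by (intro span_sum span_scale span_base) auto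
next
  fix s assume "s \<in> g ` Y"
  then obtain z where z: "z \<in> Y" "s = g z" by auto
  have "B (\<Sum>y\<in>Y. c y *\<^sub>R g y) s = (\<Sum>y\<in>Y. c y * K y z)"
    unfolding form_sum_left z(2) using z(1) by (intro sum.cong) (auto simp: realizes_kernel[OF g])
  also have "\<dots> = B (\<Sum>y\<in>Y. c y *\<^sub>R f y) (f z)"
    unfolding form_sum_left using z(1) by (intro sum.cong) (auto simp: realizes_kernel[OF f])
  finally show "B (\<Sum>y\<in>Y. c y *\<^sub>R g y) s = 0"
    using zero bilinear by (simp add: bilinear_lzero)
qed

definition indep_family :: "('a \<Rightarrow> 'v) \<Rightarrow> 'a set \<Rightarrow> bool" where
  "indep_family f Y \<longleftrightarrow> (\<forall>c. (\<Sum>y\<in>Y. c y *\<^sub>R f y) = 0 \<longrightarrow> (\<forall>y\<in>Y. c y = 0))"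

lemma indep_family_card_le:
  assumes fin: "finite Y" and ind: "indep_family f Y"
  shows "card Y \<le> DIM('v)"
proof -
  have inj: "inj_on f Y"
  proof (rule inj_onI, rule ccontr)
    fix x y assume xy: "x \<in> Y" "y \<in> Y" "f x = f y" "x \<noteq> y"
    define c where "c z = (if z = x then 1 else 0) - (if z = y then 1 else (0::real))" for z
    have "(\<Sum>z\<in>Y. c z *\<^sub>R f z) =
        (\<Sum>z\<in>Y. if z = x then f z else 0) - (\<Sum>z\<in>Y. if z = y then f z else 0)"
      unfolding sum_subtractf[symmetric] by (intro sum.cong) (auto simp: c_def)
    also have "\<dots> = 0"
      using xy fin by simp
    finally have "c x = 0"
      using ind xy(1) by (auto simp: indep_family_def)
    then show False
      using xy by (simp add: c_def)
  qed
  have "independent (f ` Y)"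
  proof (rule independent_if_scalars_zero)
    show "finite (f ` Y)" using fin by simp
  next
    fix c v assume 0: "(\<Sum>v\<in>f ` Y. c v *\<^sub>R v) = 0" and v: "v \<in> f ` Y"
    have "(\<Sum>y\<in>Y. c (f y) *\<^sub>R f y) = 0"
      using 0 by (simp add: sum.reindex[OF inj])
    from ind[unfolded indep_family_def, rule_format, of "\<lambda>y. c (f y)", OF this]
    show "c v = 0" using v by auto
  qed
  then have "card (f ` Y) \<le> DIM('v)"
    using independent_bound by blast
  then show ?thesis
    by (simp add: card_image[OF inj])
qed

text \<open>
  The coefficients that express a point through a maximal independent family are the same for all
  realizations \<open>h\<close>, and hence may be transported to the realization chosen for \<open>Y\<close>.
\<close>

lemma dependent_coefficients:
  assumes fin: "finite Y" and f: "realizes f K Y" and ind: "indep_family f Y"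
    and g: "realizes g K (insert x Y)"
    and dep: "x \<notin> Y \<Longrightarrow> \<not> indep_family g (insert x Y)"
  shows "\<exists>c. \<forall>h. realizes h K (insert x Y) \<longrightarrow> h x = (\<Sum>y\<in>Y. c y *\<^sub>R h y)"
proof (cases "x \<in> Y")
  case True
  show ?thesis
  proof (intro exI allI impI)
    fix h :: "'a \<Rightarrow> 'v"
    have "(\<Sum>y\<in>Y. (if y = x then 1 else 0) *\<^sub>R h y) = (\<Sum>y\<in>Y. if y = x then h y else 0)"
      by (intro sum.cong) auto
    also have "\<dots> = h x"
      using True fin by simp
    finally show "h x = (\<Sum>y\<in>Y. (if y = x then 1 else 0) *\<^sub>R h y)" ..
  qed
next
  case False
  then obtain a z where a: "(\<Sum>y\<in>insert x Y. a y *\<^sub>R g y) = 0" and z: "z \<in> insert x Y" "a z \<noteq> 0"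
    using dep by (auto simp: indep_family_def)
  have ax: "a x \<noteq> 0"
  proof
    assume ax: "a x = 0"
    then have "(\<Sum>y\<in>Y. a y *\<^sub>R g y) = 0"
      using a fin False by simp
    then have "(\<Sum>y\<in>Y. a y *\<^sub>R f y) = 0"
      by (rule relation_transfer[OF realizes_mono[OF g subset_insertI] f])
    then have "\<forall>y\<in>Y. a y = 0"
      using ind by (simp add: indep_family_def)
    then show False
      using z ax by auto
  qed
  show ?thesis
  proof (intro exI allI impI)
    fix h assume h: "realizes h K (insert x Y)"
    have "a x *\<^sub>R h x + (\<Sum>y\<in>Y. a y *\<^sub>R h y) = 0"
      using relation_transfer[OF g h a] fin False by simp
    then have "a x *\<^sub>R h x = - (\<Sum>y\<in>Y. a y *\<^sub>R h y)"
      by (simp add: eq_neg_iff_add_eq_0)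
    then have "(1 / a x) *\<^sub>R (a x *\<^sub>R h x) = (1 / a x) *\<^sub>R (- (\<Sum>y\<in>Y. a y *\<^sub>R h y))"
      by simp
    then have "h x = - ((1 / a x) *\<^sub>R (\<Sum>y\<in>Y. a y *\<^sub>R h y))"
      using ax by simp
    then show "h x = (\<Sum>y\<in>Y. (- a y / a x) *\<^sub>R h y)"
      by (simp add: scaleR_sum_right sum_negf[symmetric])
  qed
qed

text \<open>
  Two points in excess of the dimension suffice: the Gram kernel is a condition on pairs, and a pair
  is tested together with a maximal independent set.
\<close>

theorem realizable_if_small_realizable:
  assumes small: "\<And>Y. Y \<subseteq> X \<Longrightarrow> finite Y \<Longrightarrow> card Y \<le> DIM('v) + 2 \<Longrightarrow> \<exists>f. realizes f K Y"
  shows "\<exists>F. realizes F K X"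
proof -
  define P where "P Y \<longleftrightarrow> Y \<subseteq> X \<and> finite Y \<and> (\<exists>f. realizes f K Y \<and> indep_family f Y)" for Y
  have "P {}"
    by (auto simp: P_def realizes_def indep_family_def)
  moreover have bound: "card Y \<le> DIM('v)" if "P Y" for Y
    using that indep_family_card_le by (auto simp: P_def)
  ultimately obtain Y where PY: "P Y" and max: "\<And>Z. P Z \<Longrightarrow> card Z \<le> card Y"
    using ex_has_greatest_nat[of P "{}" card "Suc DIM('v)"]
    by (auto simp: less_Suc_eq_le)
  then obtain f where YX: "Y \<subseteq> X" and fin: "finite Y" and f: "realizes f K Y"
      and ind: "indep_family f Y"
    by (auto simp: P_def)
  have pair: "\<exists>g. realizes g K (insert x (insert x' Y))" if "x \<in> X" "x' \<in> X" for x x'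
  proof (rule small)
    show "card (insert x (insert x' Y)) \<le> DIM('v) + 2"
      using bound[OF PY] fin by (simp add: card_insert_if)
  qed (use that YX fin in auto)
  have "\<exists>c. \<forall>h. realizes h K (insert x Y) \<longrightarrow> h x = (\<Sum>y\<in>Y. c y *\<^sub>R h y)" if x: "x \<in> X" for x
  proof -
    obtain g where g: "realizes g K (insert x Y)"
      using pair[OF x x] by auto
    have "\<not> indep_family g (insert x Y)" if "x \<notin> Y"
    proof
      assume "indep_family g (insert x Y)"
      then have "P (insert x Y)"
        using x YX fin g by (auto simp: P_def)
      then show False
        using max[of "insert x Y"] that fin by simp
    qed
    then show ?thesis
      by (rule dependent_coefficients[OF fin f ind g])
  qed
  then obtain c where c: "\<And>x h. x \<in> X \<Longrightarrow> realizes h K (insert x Y) \<Longrightarrow>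
      h x = (\<Sum>y\<in>Y. c x y *\<^sub>R h y)"
    by metis
  define F where "F x = (\<Sum>y\<in>Y. c x y *\<^sub>R f y)" for x
  have kernel: "B (F x) (F x') = K x x'" if x: "x \<in> X" and x': "x' \<in> X" for x x'
  proof -
    obtain g where g: "realizes g K (insert x (insert x' Y))"
      using pair[OF x x'] by auto
    have gx: "g x = (\<Sum>y\<in>Y. c x y *\<^sub>R g y)" and gx': "g x' = (\<Sum>y\<in>Y. c x' y *\<^sub>R g y)"
      by (auto intro!: c x x' realizes_mono[OF g])
    have "B (F x) (F x') = (\<Sum>y\<in>Y. c x y * (\<Sum>z\<in>Y. c x' z * B (f y) (f z)))"
      by (simp only: F_def form_sum_left) (simp only: form_sum_right)
    also have "\<dots> = (\<Sum>y\<in>Y. c x y * (\<Sum>z\<in>Y. c x' z * B (g y) (g z)))"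
      by (simp add: realizes_kernel[OF f] realizes_kernel[OF g])
    also have "\<dots> = B (g x) (g x')"
      by (simp only: gx gx' form_sum_left) (simp only: form_sum_right)
    also have "\<dots> = K x x'"
      by (rule realizes_kernel[OF g]) auto
    finally show ?thesis .
  qed
  have "F x \<in> M" if x: "x \<in> X" for x
  proof -
    obtain g where g: "realizes g K (insert x Y)"
      using pair[OF x x] by auto
    have gx: "g x = (\<Sum>y\<in>Y. c x y *\<^sub>R g y)"
      by (rule c[OF x g])
    have gM: "g x \<in> M"
      by (rule realizes_in[OF g]) simp
    with gx zero_notin have "Y \<noteq> {}" by auto
    then obtain y where y: "y \<in> Y" by auto
    have gy: "g y \<in> M"
      by (rule realizes_in[OF g]) (simp add: y)
    have "B (f y) (F x) = (\<Sum>z\<in>Y. c x z * B (f y) (f z))"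
      by (simp add: F_def form_sum_right)
    also have "\<dots> = (\<Sum>z\<in>Y. c x z * B (g y) (g z))"
      using y by (simp add: realizes_kernel[OF f] realizes_kernel[OF g])
    also have "\<dots> = B (g y) (g x)"
      by (subst gx) (simp only: form_sum_right)
    finally have "B (f y) (F x) = B (g y) (g x)" .
    moreover have "B (F x) (F x) = B (g x) (g x)"
      by (simp add: kernel[OF x x] realizes_kernel[OF g])
    ultimately show ?thesis
      using recognise[OF realizes_in[OF f y] gy gM] by blast
  qed
  with kernel have "realizes F K X"
    by (auto simp: realizes_def)
  then show ?thesis by blast
qed

end

section \<open>The sphere\<close>

interpretation sphere_model: gram_model "inner :: real ^ 's \<Rightarrow> _" "sphere 0 1 :: (real ^ 's) set"
proof
  fix S :: "(real ^ 's) set" and v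
  assume v: "v \<in> span S" and orth: "\<And>s. s \<in> S \<Longrightarrow> v \<bullet> s = 0"
  have "orthogonal v v"
    by (rule orthogonal_to_span[OF v]) (simp add: orthogonal_def orth)
  then show "v = 0" by (simp add: orthogonal_def)
qed (auto simp: bilinear_conv_bounded_bilinear bounded_bilinear_inner norm_eq_sqrt_inner)

lemma sphere_dist_eq_iff:
  assumes "x \<in> sphere 0 1" "y \<in> sphere 0 1"
  shows "sphere_dist x y = r \<longleftrightarrow> 0 \<le> r \<and> r \<le> 1 \<and> x \<bullet> y = cos (pi * r)"
proof
  have "\<bar>x \<bullet> y\<bar> \<le> 1"
    using Cauchy_Schwarz_ineq2[of x y] assms by simp
  then have xy: "-1 \<le> x \<bullet> y" "x \<bullet> y \<le> 1" by auto
  assume "sphere_dist x y = r"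
  then have r: "arccos (x \<bullet> y) = pi * r"
    by (auto simp: sphere_dist_def)
  then have "cos (pi * r) = x \<bullet> y"
    using cos_arccos[OF xy] by simp
  moreover have "0 \<le> pi * r" "pi * r \<le> pi * 1"
    using arccos_bounded[OF xy] r by simp_all
  then have "0 \<le> r" "r \<le> 1"
    using pi_gt_zero by (simp_all add: zero_le_mult_iff)
  ultimately show "0 \<le> r \<and> r \<le> 1 \<and> x \<bullet> y = cos (pi * r)" by simp
next
  assume r: "0 \<le> r \<and> r \<le> 1 \<and> x \<bullet> y = cos (pi * r)"
  then have "arccos (x \<bullet> y) = pi * r"
    by (simp add: arccos_cos)
  then show "sphere_dist x y = r"
    by (simp add: sphere_dist_def)
qed

lemma sphere_embeddable_iff:
  "isometrically_embeddable Y d (sphere 0 1 :: (real ^ 's) set) sphere_dist \<longleftrightarrow>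
     (\<forall>x\<in>Y. \<forall>y\<in>Y. 0 \<le> d x y \<and> d x y \<le> 1) \<and>
     (\<exists>f :: _ \<Rightarrow> real ^ 's. sphere_model.realizes f (\<lambda>x y. cos (pi * d x y)) Y)"
  (is "?L \<longleftrightarrow> ?bounded \<and> ?R")
proof (intro iffI conjI; (elim conjE)?)
  assume ?L
  then obtain f :: "_ \<Rightarrow> real ^ 's"
    where fM: "f ` Y \<subseteq> sphere 0 1" and f: "\<forall>x\<in>Y. \<forall>y\<in>Y. sphere_dist (f x) (f y) = d x y"
    unfolding isometrically_embeddable_def by blast
  have *: "0 \<le> d x y \<and> d x y \<le> 1 \<and> f x \<bullet> f y = cos (pi * d x y)" if "x \<in> Y" "y \<in> Y" for x y
    using sphere_dist_eq_iff[of "f x" "f y" "d x y"] fM f that by blast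
  then show ?bounded
    by blast
  have "sphere_model.realizes f (\<lambda>x y. cos (pi * d x y)) Y"
    unfolding sphere_model.realizes_def using fM * by blast
  then show ?R by blast
next
  assume bounded: ?bounded and ?R
  then obtain f :: "_ \<Rightarrow> real ^ 's"
    where f: "sphere_model.realizes f (\<lambda>x y. cos (pi * d x y)) Y" by blast
  have "sphere_dist (f x) (f y) = d x y" if xy: "x \<in> Y" "y \<in> Y" for x y
  proof -
    have "0 \<le> d x y \<and> d x y \<le> 1 \<and> f x \<bullet> f y = cos (pi * d x y)"
      using bounded xy sphere_model.realizes_kernel[OF f xy] by blast
    then show ?thesis
      using sphere_dist_eq_iff sphere_model.realizes_in[OF f] xy by metis
  qed
  moreover have "f ` Y \<subseteq> sphere 0 1"
    using f by (simp add: sphere_model.realizes_def)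
  ultimately show ?L
    unfolding isometrically_embeddable_def by blast
qed

theorem sphere_embeddable_if_small_embeddable:
  assumes small: "\<And>Y. Y \<subseteq> X \<Longrightarrow> finite Y \<Longrightarrow> card Y \<le> CARD('s) + 2 \<Longrightarrow>
      isometrically_embeddable Y d (sphere 0 1 :: (real ^ 's) set) sphere_dist"
  shows "isometrically_embeddable X d (sphere 0 1 :: (real ^ 's) set) sphere_dist"
proof -
  have "\<exists>f :: _ \<Rightarrow> real ^ 's. sphere_model.realizes f (\<lambda>x y. cos (pi * d x y)) X"
    by (rule sphere_model.realizable_if_small_realizable)
      (use small in \<open>auto simp: sphere_embeddable_iff\<close>)
  moreover have "0 \<le> d x y \<and> d x y \<le> 1" if "x \<in> X" "y \<in> X" for x y
  proof -
    have "isometrically_embeddable {x, y} d (sphere 0 1 :: (real ^ 's) set) sphere_dist"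
      by (rule small) (use that in \<open>auto simp: card_insert_if\<close>)
    then show ?thesis
      by (simp add: sphere_embeddable_iff)
  qed
  ultimately show ?thesis
    by (simp add: sphere_embeddable_iff)
qed

section \<open>Hyperbolic space\<close>

definition lorentz :: "(real ^ 'n) \<times> real \<Rightarrow> (real ^ 'n) \<times> real \<Rightarrow> real" where
  "lorentz v w = fst v \<bullet> fst w - snd v * snd w"

definition hyperboloid :: "((real ^ 'n) \<times> real) set" where
  "hyperboloid = range (\<lambda>x. (x, hyp_weight x))"

lemma hyp_weight_square: "(hyp_weight x)\<^sup>2 = 1 + (norm x)\<^sup>2"
  by (simp add: hyp_weight_def)

lemma norm_less_hyp_weight: "norm x < hyp_weight x"
  unfolding hyp_weight_def by (intro real_less_rsqrt) linarith

lemma hyp_weight_pos: "0 < hyp_weight x"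
  using norm_less_hyp_weight[of x] norm_ge_zero[of x] by linarith

lemma bilinear_lorentz: "bilinear lorentz"
  unfolding bilinear_def
  by (intro conjI allI linearI)
    (simp_all add: lorentz_def inner_add_left inner_add_right distrib_left distrib_right
      right_diff_distrib)

text \<open>
  This is Cauchy--Schwarz together with the arithmetic-geometric mean inequality
  \<open>1 + \<parallel>x\<parallel> \<parallel>y\<parallel> \<le> [x] [y]\<close>.
\<close>

lemma hyp_form_ge_1: "1 \<le> hyp_weight x * hyp_weight y - x \<bullet> y"
proof -
  have "(1 + norm x * norm y)\<^sup>2 + (norm x - norm y)\<^sup>2 = (1 + (norm x)\<^sup>2) * (1 + (norm y)\<^sup>2)"
    by algebra
  also have "\<dots> = (hyp_weight x * hyp_weight y)\<^sup>2"
    by (simp only: power_mult_distrib hyp_weight_square)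
  finally have "(1 + norm x * norm y)\<^sup>2 \<le> (hyp_weight x * hyp_weight y)\<^sup>2"
    using zero_le_power2[of "norm x - norm y"] by linarith
  then have "1 + norm x * norm y \<le> hyp_weight x * hyp_weight y"
    by (rule power2_le_imp_le) (simp add: hyp_weight_pos less_imp_le)
  then show ?thesis
    using norm_cauchy_schwarz[of x y] by linarith
qed

text \<open>
  A point of the hyperboloid is timelike, so its Lorentz-orthogonal complement contains no nonzero
  null vector.
\<close>

lemma null_orthogonal_hyperboloid_imp_zero:
  assumes m: "m \<in> hyperboloid" and orth: "lorentz v m = 0" and null: "lorentz v v = 0"
  shows "v = 0"
proof -
  obtain x s where v: "v = (x, s)" by (cases v)
  obtain y where y: "m = (y, hyp_weight y)" using m by (auto simp: hyperboloid_def)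
  have "(norm x)\<^sup>2 = s\<^sup>2"
    using null unfolding power2_norm_eq_inner by (simp add: v lorentz_def power2_eq_square)
  then have x: "norm x = \<bar>s\<bar>"
    by (metis abs_norm_cancel power2_eq_iff abs_eq_iff)
  have "s * hyp_weight y = x \<bullet> y"
    using orth by (simp add: v y lorentz_def)
  then have "\<bar>s\<bar> * hyp_weight y = \<bar>x \<bullet> y\<bar>"
    using hyp_weight_pos[of y] by (metis abs_mult abs_of_pos)
  also have "\<dots> \<le> \<bar>s\<bar> * norm y"
    using Cauchy_Schwarz_ineq2[of x y] x by simp
  finally have "s = 0"
    using norm_less_hyp_weight[of y] by (cases "s = 0") auto
  then show ?thesis
    using x v by (simp add: zero_prod_def)
qed

interpretation hyperboloid_model: gram_model "lorentz :: (real ^ 'h) \<times> real \<Rightarrow> _" hyperboloid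
proof
  show "bilinear (lorentz :: (real ^ 'h) \<times> real \<Rightarrow> _)"
    by (rule bilinear_lorentz)
  show "(0 :: (real ^ 'h) \<times> real) \<notin> hyperboloid"
  proof
    assume "(0 :: (real ^ 'h) \<times> real) \<in> hyperboloid"
    then obtain x :: "real ^ 'h" where "hyp_weight x = 0"
      by (auto simp: hyperboloid_def zero_prod_def)
    then show False
      using hyp_weight_pos[of x] by simp
  qed
next
  fix S :: "((real ^ 'h) \<times> real) set" and v
  assume S: "S \<subseteq> hyperboloid" and v: "v \<in> span S" and orth: "\<And>s. s \<in> S \<Longrightarrow> lorentz v s = 0"
  show "v = 0"
  proof (cases "S = {}")
    case False
    then obtain m where m: "m \<in> S" by auto
    have "linear (lorentz v)"
      using bilinear_lorentz unfolding bilinear_def by blast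
    then have "lorentz v v = 0"
      using linear_eq_0_on_span[of "lorentz v", OF _ orth v] by blast
    then show ?thesis
      using null_orthogonal_hyperboloid_imp_zero[of m v] m S orth by auto
  qed (use v in simp)
next
  fix v m p q :: "(real ^ 'h) \<times> real"
  assume M: "m \<in> hyperboloid" "p \<in> hyperboloid" "q \<in> hyperboloid"
    and vv: "lorentz v v = lorentz q q" and mv: "lorentz m v = lorentz p q"
  obtain x s where v: "v = (x, s)" by (cases v)
  obtain y where y: "m = (y, hyp_weight y)" using M by (auto simp: hyperboloid_def)
  obtain a where a: "p = (a, hyp_weight a)" using M by (auto simp: hyperboloid_def)
  obtain b where b: "q = (b, hyp_weight b)" using M by (auto simp: hyperboloid_def)
  have "lorentz q q = (norm b)\<^sup>2 - (hyp_weight b)\<^sup>2"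
    unfolding power2_norm_eq_inner by (simp add: b lorentz_def power2_eq_square)
  then have "lorentz q q = -1"
    by (simp add: hyp_weight_square)
  then have "s\<^sup>2 = 1 + (norm x)\<^sup>2"
    using vv unfolding power2_norm_eq_inner by (simp add: v lorentz_def power2_eq_square)
  then have s: "\<bar>s\<bar> = hyp_weight x"
    by (metis hyp_weight_def real_sqrt_abs)
  \<comment> \<open>On the lower sheet \<open>lorentz m v\<close> would be positive, whereas \<open>lorentz p q \<le> -1\<close>.\<close>
  have "s = hyp_weight x"
  proof (rule ccontr)
    assume "s \<noteq> hyp_weight x"
    then have s': "s = - hyp_weight x" using s by linarith
    have "y \<bullet> x + hyp_weight y * hyp_weight x \<le> -1"
      using mv hyp_form_ge_1[of a b] by (simp add: v y a b lorentz_def s')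
    moreover have "1 \<le> hyp_weight y * hyp_weight (- x) - y \<bullet> (- x)"
      by (rule hyp_form_ge_1)
    ultimately show False
      by (simp add: hyp_weight_def)
  qed
  then show "v \<in> hyperboloid"
    by (simp add: v hyperboloid_def)
qed

lemma hyp_dist_eq_iff:
  "hyp_dist x y = r \<longleftrightarrow> 0 \<le> r \<and> lorentz (x, hyp_weight x) (y, hyp_weight y) = - cosh r"
proof
  assume "hyp_dist x y = r"
  then show "0 \<le> r \<and> lorentz (x, hyp_weight x) (y, hyp_weight y) = - cosh r"
    using cosh_arcosh_real[OF hyp_form_ge_1[of x y]] arcosh_nonneg_real[OF hyp_form_ge_1[of x y]]
    by (auto simp: hyp_dist_def lorentz_def)
next
  assume r: "0 \<le> r \<and> lorentz (x, hyp_weight x) (y, hyp_weight y) = - cosh r"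
  then have "hyp_weight x * hyp_weight y - x \<bullet> y = cosh r"
    by (simp add: lorentz_def)
  then show "hyp_dist x y = r"
    using r by (simp add: hyp_dist_def arcosh_cosh_real)
qed

lemma hyp_embeddable_iff:
  "isometrically_embeddable Y d (UNIV :: (real ^ 'h) set) hyp_dist \<longleftrightarrow>
     (\<forall>x\<in>Y. \<forall>y\<in>Y. 0 \<le> d x y) \<and>
     (\<exists>f :: _ \<Rightarrow> (real ^ 'h) \<times> real. hyperboloid_model.realizes f (\<lambda>x y. - cosh (d x y)) Y)"
  (is "?L \<longleftrightarrow> ?nonneg \<and> ?R")
proof (intro iffI conjI; (elim conjE)?)
  assume ?L
  then obtain f :: "_ \<Rightarrow> real ^ 'h" where f: "\<forall>x\<in>Y. \<forall>y\<in>Y. hyp_dist (f x) (f y) = d x y"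
    by (auto simp: isometrically_embeddable_def)
  then show ?nonneg
    by (simp add: hyp_dist_eq_iff)
  have "hyperboloid_model.realizes (\<lambda>x. (f x, hyp_weight (f x))) (\<lambda>x y. - cosh (d x y)) Y"
    using f unfolding hyperboloid_model.realizes_def
    by (auto simp: hyp_dist_eq_iff hyperboloid_def)
  then show ?R by blast
next
  assume nonneg: ?nonneg and ?R
  then obtain f :: "_ \<Rightarrow> (real ^ 'h) \<times> real"
    where f: "hyperboloid_model.realizes f (\<lambda>x y. - cosh (d x y)) Y" by blast
  have "f x = (fst (f x), hyp_weight (fst (f x)))" if "x \<in> Y" for x
    using hyperboloid_model.realizes_in[OF f that] by (auto simp: hyperboloid_def)
  then have "hyp_dist (fst (f x)) (fst (f y)) = d x y" if "x \<in> Y" "y \<in> Y" for x y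
    using that nonneg hyperboloid_model.realizes_kernel[OF f that]
    by (metis hyp_dist_eq_iff)
  then show ?L
    unfolding isometrically_embeddable_def by (intro exI[of _ "\<lambda>x. fst (f x)"]) auto
qed

theorem hyp_embeddable_if_small_embeddable:
  assumes small: "\<And>Y. Y \<subseteq> X \<Longrightarrow> finite Y \<Longrightarrow> card Y \<le> CARD('h) + 3 \<Longrightarrow>
      isometrically_embeddable Y d (UNIV :: (real ^ 'h) set) hyp_dist"
  shows "isometrically_embeddable X d (UNIV :: (real ^ 'h) set) hyp_dist"
proof -
  have "\<exists>f :: _ \<Rightarrow> (real ^ 'h) \<times> real. hyperboloid_model.realizes f (\<lambda>x y. - cosh (d x y)) X"
    by (rule hyperboloid_model.realizable_if_small_realizable)
      (use small in \<open>auto simp: hyp_embeddable_iff\<close>)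
  moreover have "0 \<le> d x y" if "x \<in> X" "y \<in> X" for x y
  proof -
    have "isometrically_embeddable {x, y} d (UNIV :: (real ^ 'h) set) hyp_dist"
      by (rule small) (use that in \<open>auto simp: card_insert_if\<close>)
    then show ?thesis
      by (simp add: hyp_embeddable_iff)
  qed
  ultimately show ?thesis
    by (simp add: hyp_embeddable_iff)
qed

section \<open>Congruence order of hyperbolic space and the sphere\<close>

lemma isometrically_embeddable_subset:
  assumes "isometrically_embeddable X d M \<rho>" "Y \<subseteq> X"
  shows "isometrically_embeddable Y d M \<rho>"
proof -
  obtain f where "f ` X \<subseteq> M" "\<forall>x\<in>X. \<forall>y\<in>X. \<rho> (f x) (f y) = d x y"
    using assms(1) unfolding isometrically_embeddable_def by blast
  then show ?thesis
    using assms(2) unfolding isometrically_embeddable_def by (intro exI[of _ f]) blast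
qed

theorem theorem6p2:
  fixes n :: nat
    and X :: "'a set"
    and d :: "'a \<Rightarrow> 'a \<Rightarrow> real"
  assumes "n > 0"
    and "CARD('h::finite) = n"
    and "CARD('s::finite) = n + 1"
    and "Metric_space X d"
  shows
    "(isometrically_embeddable X d (UNIV :: (real ^ 'h) set) hyp_dist \<longleftrightarrow>
        (\<forall>Y\<subseteq>X. finite Y \<and> card Y \<le> n + 3 \<longrightarrow>
           isometrically_embeddable Y d (UNIV :: (real ^ 'h) set) hyp_dist))
     \<and>
     (isometrically_embeddable X d (sphere 0 1 :: (real ^ 's) set) sphere_dist \<longleftrightarrow>
        (\<forall>Y\<subseteq>X. finite Y \<and> card Y \<le> n + 3 \<longrightarrow>
           isometrically_embeddable Y d (sphere 0 1 :: (real ^ 's) set) sphere_dist))"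
proof (intro conjI iffI)
  assume "\<forall>Y\<subseteq>X. finite Y \<and> card Y \<le> n + 3 \<longrightarrow>
      isometrically_embeddable Y d (UNIV :: (real ^ 'h) set) hyp_dist"
  then show "isometrically_embeddable X d (UNIV :: (real ^ 'h) set) hyp_dist"
    using hyp_embeddable_if_small_embeddable[where 'h = 'h, of X d] by (simp add: assms(2))
next
  assume "\<forall>Y\<subseteq>X. finite Y \<and> card Y \<le> n + 3 \<longrightarrow>
      isometrically_embeddable Y d (sphere 0 1 :: (real ^ 's) set) sphere_dist"
  then show "isometrically_embeddable X d (sphere 0 1 :: (real ^ 's) set) sphere_dist"
    using sphere_embeddable_if_small_embeddable[where 's = 's, of X d] by (simp add: assms(3))
qed (use isometrically_embeddable_subset in metis)+

end
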